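(* Consider a connected graph on the nodes $\{1,\dots,n\}$ described by a weighted positive semidefinite Laplacian $L\in\mathbb{R}^{n\times n}$ (which has rank $n-1$). For distinct nodes $i,j$ let $$R_{ij} = (\boldsymbol{e}_i-\boldsymbol{e}_j)^T L^+(\boldsymbol{e}_i-\boldsymbol{e}_j)$$ denote the effective resistance between $i$ and $j$, and let $$\tilde R_{ij} = \boldsymbol{d}^T L_{\mathcal{SS}}^+\,\boldsymbol{d},\qquad \boldsymbol{d}=\begin{bmatrix}1\\-1\end{bmatrix},\qquad L_{\mathcal{SS}}=\begin{bmatrix}L_{ii}&L_{ij}\\L_{ji}&L_{jj}\end{bmatrix},$$ be the approximation defined from the principal submatrix of $L$ indexed by $\mathcal{S}=\{i,j\}$. Then: (1) $\tilde R_{ij}\le R_{ij}$ for all distinct $i,j$. (2) With $\gamma = 2/\lambda_2(L)$, for all distinct nodes $i,j,k$: if $\tilde R_{ij}-\tilde R_{ik}<-\gamma$ then $R_{ij}-R_{ik}<0$; and if $\tilde R_{ij}-\tilde R_{ik}>\gamma$ then $R_{ij}-R_{ik}>0$. (3) For all distinct nodes $i,j,k$, $$\bigl|(\tilde R_{ij}-\tilde R_{ik})-(R_{ij}-R_{ik})\bigr|\le \frac{2}{\lambda_2(L)}.$$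
   Context: The weighted Laplacian of a graph with $n$ nodes and $m$ edges is $L=A^TWA$, where $A$ is the $m\times n$ incidence matrix (the row of an edge from node $j$ to node $k$ has entry $-1$ in column $j$, entry $1$ in column $k$, and zeros elsewhere) and $W$ is the $m\times m$ real diagonal matrix of edge conductances. For a connected graph, $L$ has rank $n-1$. The eigenvalues of $L$ are ordered $0=\lambda_1(L)\le\lambda_2(L)\le\dots\le\lambda_n(L)$. $M^+$ denotes the Moore–Penrose pseudoinverse of a matrix $M$, and $\boldsymbol{e}_i$ is the $i$-th standard basis vector of $\mathbb{R}^n$. *)

theory Defs
  imports
    "HOL-Analysis.Analysis"
    "HOL-Computational_Algebra.Polynomial"
    "Graph_Theory.Digraph_Component"
begin

text \<open>
  A graph is given with an arbitrary orientation of its edges, as a digraph whose nodes and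
  edges are exhausted by the finite types \<open>'n\<close> and \<open>'m\<close>. The intended use is for loop-free graphs.
\<close>

definition incidence_matrix :: "('n::finite, 'm::finite) pre_digraph \<Rightarrow> real^'n^'m" where
  "incidence_matrix G =
     (\<chi> e v. if v = tail G e then - 1 else if v = head G e then 1 else 0)"

definition diagonal_matrix :: "('m::finite \<Rightarrow> real) \<Rightarrow> real^'m^'m" where
  "diagonal_matrix w = (\<chi> e f. if e = f then w e else 0)"

definition weighted_laplacian ::
    "('n::finite, 'm::finite) pre_digraph \<Rightarrow> ('m \<Rightarrow> real) \<Rightarrow> real^'n^'n" where
  "weighted_laplacian G w =
     transpose (incidence_matrix G) ** diagonal_matrix w ** incidence_matrix G"

definition pos_semidef :: "real^'n^'n \<Rightarrow> bool" where
  "pos_semidef M \<longleftrightarrow> transpose M = M \<and> (\<forall>x. 0 \<le> x \<bullet> (M *v x))"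

definition char_polynomial :: "real^'n^'n \<Rightarrow> real poly" where
  "char_polynomial M = det (\<chi> i j. (if i = j then [:0, 1:] else 0) - [:M $ i $ j:])"

text \<open>
  The \<open>k\<close>-th smallest eigenvalue, counted with multiplicity, for \<open>1 \<le> k \<le> n\<close>. Only real roots
  of the characteristic polynomial are counted, which for a symmetric matrix are all of them.
\<close>

definition nth_eigenvalue :: "nat \<Rightarrow> real^'n^'n \<Rightarrow> real" where
  "nth_eigenvalue k M = sorted_list_of_multiset (proots (char_polynomial M)) ! (k - 1)"

text \<open>The four Penrose conditions, which determine \<open>X\<close> uniquely.\<close>

definition is_pseudoinverse :: "real^'n^'m \<Rightarrow> real^'m^'n \<Rightarrow> bool" where
  "is_pseudoinverse M X \<longleftrightarrow>
     M ** X ** M = M \<and> X ** M ** X = X \<and>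
     transpose (M ** X) = M ** X \<and> transpose (X ** M) = X ** M"

lemma is_pseudoinverse_unique:
  assumes X: "is_pseudoinverse M X" and Y: "is_pseudoinverse M Y"
  shows "X = Y"
proof -
  have "M ** X = transpose (M ** Y ** (M ** X))"
    using X Y unfolding is_pseudoinverse_def by (simp add: matrix_mul_assoc)
  also have "\<dots> = M ** X ** (M ** Y)"
    using X Y unfolding is_pseudoinverse_def by (simp add: matrix_transpose_mul)
  also have "\<dots> = M ** Y"
    using X unfolding is_pseudoinverse_def by (simp add: matrix_mul_assoc)
  finally have MX: "M ** X = M ** Y" .
  have "X ** M = transpose (X ** M ** (Y ** M))"
    using X Y unfolding is_pseudoinverse_def by (metis matrix_mul_assoc)
  also have "\<dots> = Y ** M ** (X ** M)"
    using X Y unfolding is_pseudoinverse_def by (simp add: matrix_transpose_mul)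
  also have "\<dots> = Y ** M"
    using X unfolding is_pseudoinverse_def by (metis matrix_mul_assoc)
  finally have XM: "X ** M = Y ** M" .
  have "X = X ** M ** X" using X by (simp add: is_pseudoinverse_def)
  also have "\<dots> = Y ** M ** Y" using MX XM by (metis matrix_mul_assoc)
  also have "\<dots> = Y" using Y by (simp add: is_pseudoinverse_def)
  finally show ?thesis .
qed

definition pseudoinverse :: "real^'n^'m \<Rightarrow> real^'m^'n" where
  "pseudoinverse M = (THE X. is_pseudoinverse M X)"

definition effective_resistance :: "real^'n^'n \<Rightarrow> 'n \<Rightarrow> 'n \<Rightarrow> real" where
  "effective_resistance L i j =
     (axis i 1 - axis j 1) \<bullet> (pseudoinverse L *v (axis i 1 - axis j 1))"

definition principal_submatrix2 :: "real^'n^'n \<Rightarrow> 'n \<Rightarrow> 'n \<Rightarrow> real^2^2" where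
  "principal_submatrix2 L i j =
     vector [vector [L $ i $ i, L $ i $ j], vector [L $ j $ i, L $ j $ j]]"

definition approx_resistance :: "real^'n^'n \<Rightarrow> 'n \<Rightarrow> 'n \<Rightarrow> real" where
  "approx_resistance L i j =
     vector [1, - 1] \<bullet> (pseudoinverse (principal_submatrix2 L i j) *v vector [1, - 1])"

end

theory Submission
  imports Defs
begin

text \<open>
  Let \<open>R'\<close> denote the approximation of \<open>R\<close>. Everything follows from
  \<open>0 \<le> R' \<le> R \<le> 2 / \<lambda>\<^sub>2\<close>, which confines every error \<open>R - R'\<close> to an interval of length
  \<open>2 / \<lambda>\<^sub>2\<close>.
  If \<open>L x = d\<close> with \<open>d = e\<^sub>i - e\<^sub>j\<close>, then \<open>R = x \<bullet> L x\<close>; likewise \<open>R' = y \<bullet> L y\<close> for a vector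
  \<open>y\<close> supported on \<open>{i, j}\<close> with \<open>d \<bullet> y = R'\<close>, so that \<open>R - R' = (x - y) \<bullet> L (x - y) \<ge> 0\<close>.
  The upper bound on \<open>R\<close> is the Rayleigh inequality for \<open>\<lambda>\<^sub>2\<close> on the orthogonal complement of
  the constant vectors.
\<close>

section \<open>Symmetric matrices: solvability, pseudoinverse, nonnegative forms\<close>

lemma symmetric_matrix_inner:
  fixes M :: "real^'n^'n"
  assumes "transpose M = M"
  shows "x \<bullet> (M *v y) = (M *v x) \<bullet> y"
  using assms by (metis dot_lmul_matrix transpose_matrix_vector)

text \<open>Fredholm alternative. Split \<open>d\<close> into \<open>y\<close> in the range and
  \<open>z\<close> orthogonal to it. By symmetry \<open>M *v z\<close> has norm zero, so
  \<open>z\<close> lies in the kernel; as \<open>d\<close> and \<open>y\<close> are both orthogonal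
  to \<open>z\<close>, so is \<open>z\<close> itself.\<close>

lemma symmetric_matrix_solvable:
  fixes M :: "real^'n^'n"
  assumes sym: "transpose M = M" and d: "\<And>v. M *v v = 0 \<Longrightarrow> d \<bullet> v = 0"
  obtains x where "M *v x = d"
proof -
  have sub: "subspace (range (\<lambda>x. M *v x))"
    by (simp add: linear_subspace_image)
  obtain y z where y: "y \<in> span (range (\<lambda>x. M *v x))"
    and z: "\<And>w. w \<in> span (range (\<lambda>x. M *v x)) \<Longrightarrow> orthogonal z w" and dyz: "d = y + z"
    using orthogonal_subspace_decomp_exists by blast
  have "(M *v z) \<bullet> (M *v z) = z \<bullet> (M *v (M *v z))"
    by (simp add: symmetric_matrix_inner[OF sym])
  also have "\<dots> = 0"
    using z[of "M *v (M *v z)"] by (simp add: span_base orthogonal_def)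
  finally have "d \<bullet> z = 0"
    using d by simp
  moreover have "z \<bullet> y = 0"
    using z[OF y] by (simp add: orthogonal_def)
  ultimately have "z = 0"
    by (simp add: dyz inner_add_left inner_add_right inner_commute)
  then have "d \<in> range (\<lambda>x. M *v x)"
    using y dyz span_eq_iff[THEN iffD2, OF sub] by simp
  then show thesis
    using that by blast
qed

lemma symmetric_matrixI:
  fixes M :: "real^'n^'n"
  assumes "\<And>x y. x \<bullet> (M *v y) = (M *v x) \<bullet> y"
  shows "transpose M = M"
proof -
  have "(\<lambda>x. transpose M *v x) = (\<lambda>x. M *v x)"
    using adjoint_unique[of "\<lambda>x. M *v x" "\<lambda>x. M *v x"] assms adjoint_matrix[of M]
    by metis
  then show ?thesis
    by (metis matrix_of_matrix_vector_mul)
qed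

text \<open>Summing the rank-one projections onto the vectors of an orthonormal basis of
  \<open>S\<close> gives such a matrix; on \<open>S\<close> the sum is the basis expansion.\<close>

lemma orthogonal_projection_matrix:
  fixes S :: "(real^'n) set"
  assumes "subspace S"
  obtains P :: "real^'n^'n" where "transpose P = P" "\<And>x. P *v x \<in> S" "\<And>x. x \<in> S \<Longrightarrow> P *v x = x"
proof -
  obtain B where B: "B \<subseteq> S" "pairwise orthogonal B" "\<And>x. x \<in> B \<Longrightarrow> norm x = 1"
    "independent B" "span B = S"
    using orthonormal_basis_subspace[OF assms] by metis
  have fin: "finite B"
    using B(4) by (rule independent_imp_finite)
  let ?p = "\<lambda>x. \<Sum>b\<in>B. (x \<bullet> b) *\<^sub>R b"
  have "linear ?p"
    by (rule linearI)
      (simp_all add: inner_add_left scaleR_add_left sum.distrib scaleR_sum_right)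
  then have P: "matrix ?p *v x = ?p x" for x
    by simp
  show thesis
  proof
    show "transpose (matrix ?p) = matrix ?p"
      by (rule symmetric_matrixI)
        (simp only: P inner_sum_left inner_sum_right inner_scaleR_left inner_scaleR_right,
          simp add: inner_commute mult.commute)
    show "matrix ?p *v x \<in> S" for x
      unfolding P B(5)[symmetric] by (intro span_sum span_scale span_base)
    show "matrix ?p *v x = x" if "x \<in> S" for x
      unfolding P using B fin that by (intro orthonormal_basis_expand) auto
  qed
qed

lemma matrix_add_rdistrib:
  fixes A B :: "real^'n^'m"
  shows "(A + B) ** C = A ** C + B ** C"
  by (simp add: matrix_eq matrix_vector_mul_assoc[symmetric] matrix_vector_mult_add_rdistrib)

lemma matrix_diff_ldistrib:
  fixes A :: "real^'n^'m"
  shows "A ** (B - C) = A ** B - A ** C"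
  by (simp add: matrix_eq matrix_vector_mul_assoc[symmetric] matrix_vector_mult_diff_distrib
      matrix_vector_mult_diff_rdistrib)

lemma matrix_diff_rdistrib:
  fixes A B :: "real^'n^'m"
  shows "(A - B) ** C = A ** C - B ** C"
  by (simp add: matrix_eq matrix_vector_mul_assoc[symmetric] matrix_vector_mult_diff_rdistrib)

text \<open>
  If \<open>P\<close> is the orthogonal projection onto the kernel of \<open>M\<close>, the pseudoinverse is
  \<open>(M + P)\<^sup>-\<^sup>1 - P\<close>.
\<close>

lemma symmetric_is_pseudoinverse_exists:
  fixes M :: "real^'n^'n"
  assumes sym: "transpose M = M"
  obtains X where "is_pseudoinverse M X"
proof -
  have "subspace {x. M *v x = 0}"
    by (simp add: subspace_def matrix_vector_right_distrib scaleR_matrix_vector_assoc[symmetric]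
        matrix_vector_mult_scaleR)
  then obtain P :: "real^'n^'n" where symP: "transpose P = P" and ker: "\<And>x. M *v (P *v x) = 0"
    and fixP: "\<And>x. M *v x = 0 \<Longrightarrow> P *v x = x"
    using orthogonal_projection_matrix[of "{x. M *v x = 0}"] by auto
  have MP: "M ** P = 0"
    using ker by (simp add: matrix_eq matrix_vector_mul_assoc)
  then have PM: "P ** M = 0"
    using sym symP by (metis matrix_transpose_mul transpose_mat mat_0)
  have PP: "P ** P = P"
    using ker fixP by (simp add: matrix_eq matrix_vector_mul_assoc[symmetric])
  \<comment> \<open>Applying \<open>P\<close> to the equation removes the \<open>M\<close> part and
    leaves \<open>P *v v = 0\<close>. Then \<open>M *v v = 0\<close> as well, and \<open>P\<close>
    fixes kernel vectors, so \<open>v = P *v v = 0\<close>.\<close>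
  have "v = 0" if "(M + P) *v v = 0" for v
  proof -
    have "0 = P *v ((M + P) *v v)"
      using that by simp
    also have "\<dots> = P *v v"
      by (simp add: matrix_vector_mul_assoc matrix_add_ldistrib PM PP)
    finally have "P *v v = 0" ..
    moreover from this have "M *v v = 0"
      using that by (simp add: matrix_vector_mult_add_rdistrib)
    ultimately show ?thesis
      using fixP by metis
  qed
  then obtain N where N: "N ** (M + P) = mat 1"
    using matrix_left_invertible_ker by blast
  then have N': "(M + P) ** N = mat 1"
    by (rule matrix_left_right_inverse1)
  have NP: "N ** P = P"
  proof -
    have "N ** P = N ** ((M + P) ** P)"
      by (simp add: matrix_add_rdistrib MP PP)
    then show ?thesis
      by (simp add: matrix_mul_assoc N)
  qed
  have PN: "P ** N = P"
  proof -
    have "P ** N = P ** (M + P) ** N"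
      by (simp add: matrix_add_ldistrib PM PP)
    then show ?thesis
      by (simp add: matrix_mul_assoc[symmetric] N')
  qed
  \<comment> \<open>Both products are the orthogonal projection onto the complement of the kernel,
    which makes the Penrose conditions a short computation.\<close>
  have MX: "M ** (N - P) = mat 1 - P"
    using N' by (simp add: matrix_diff_ldistrib matrix_add_rdistrib MP PN eq_diff_eq)
  have XM: "(N - P) ** M = mat 1 - P"
    using N by (simp add: matrix_diff_rdistrib matrix_add_ldistrib PM NP eq_diff_eq)
  have "transpose (mat 1 - P) = mat 1 - P"
    using symP by (simp add: transpose_def mat_def vec_eq_iff)
  then have "is_pseudoinverse M (N - P)"
    unfolding is_pseudoinverse_def MX XM
    by (simp add: matrix_diff_ldistrib matrix_diff_rdistrib PM PN PP)
  then show thesis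
    by (rule that)
qed

lemma pseudoinverse_symmetric:
  fixes M :: "real^'n^'n"
  assumes "transpose M = M"
  shows "is_pseudoinverse M (pseudoinverse M)"
  unfolding pseudoinverse_def
  using symmetric_is_pseudoinverse_exists[OF assms] is_pseudoinverse_unique by (metis theI)

text \<open>Trades the pseudoinverse for an arbitrary solution \<open>x\<close>: substitute
  \<open>M *v x\<close> for \<open>d\<close>, move one factor across by symmetry, and apply the
  first Penrose condition.\<close>

lemma pseudoinverse_quadratic_form:
  fixes M :: "real^'n^'n"
  assumes sym: "transpose M = M" and x: "M *v x = d"
  shows "d \<bullet> (pseudoinverse M *v d) = x \<bullet> d"
proof -
  have "d \<bullet> (pseudoinverse M *v d) = x \<bullet> ((M ** pseudoinverse M ** M) *v x)"
    by (simp add: x[symmetric] symmetric_matrix_inner[OF sym] matrix_vector_mul_assoc[symmetric])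
  also have "\<dots> = x \<bullet> d"
    using pseudoinverse_symmetric[OF sym] x by (simp add: is_pseudoinverse_def)
  finally show ?thesis .
qed


text \<open>On \<open>S\<close> the form attains its minimum 0 at \<open>v\<close>, so its
  derivative along any direction in \<open>S\<close> vanishes; in the direction
  \<open>u = M *v v\<close> that derivative is \<open>2 * (u \<bullet> u)\<close>. Applied below to
  the whole space and to the hyperplane orthogonal to the constants.\<close>

lemma nonneg_form_kernel:
  fixes M :: "real^'n^'n"
  assumes sym: "transpose M = M" and S: "subspace S"
    and nonneg: "\<And>x. x \<in> S \<Longrightarrow> 0 \<le> x \<bullet> (M *v x)"
    and v: "v \<in> S" "M *v v \<in> S" "v \<bullet> (M *v v) = 0"
  shows "M *v v = 0"
proof (rule ccontr)
  assume "M *v v \<noteq> 0"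
  define u where "u = M *v v"
  define a where "a = u \<bullet> u"
  define c where "c = u \<bullet> (M *v u)"
  have a: "a > 0"
    using \<open>M *v v \<noteq> 0\<close> by (simp add: a_def u_def)
  have c: "c \<ge> 0"
    using nonneg v by (simp add: c_def u_def)
  \<comment> \<open>Along the line the form is \<open>2 * t * a + t\<^sup>2 * c\<close>. This
    \<open>t\<close> turns it into \<open>t * a - t\<^sup>2\<close>, which is negative; the added 1
    keeps the denominator positive when \<open>c = 0\<close>.\<close>
  define t where "t = - a / (c + 1)"
  have t: "t < 0" and tc: "t * c = - a - t"
    using a c by (simp_all add: t_def divide_simps) (simp add: algebra_simps)
  have "0 \<le> (v + t *\<^sub>R u) \<bullet> (M *v (v + t *\<^sub>R u))"
    using S v by (intro nonneg) (simp add: subspace_add subspace_scale u_def)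
  also have "\<dots> = 2 * t * a + t\<^sup>2 * c"
    using v symmetric_matrix_inner[OF sym, of v u]
    by (simp add: matrix_vector_right_distrib matrix_vector_mult_scaleR inner_add_left
        inner_add_right a_def c_def u_def power2_eq_square distrib_left)
  also have "\<dots> = t * a - t\<^sup>2"
    using tc by (simp add: power2_eq_square mult.assoc right_diff_distrib)
  also have "\<dots> < 0"
    using mult_neg_pos[OF t a] zero_le_power2[of t] by linarith
  finally show False
    by simp
qed

lemma pos_semidef_kernel:
  fixes M :: "real^'n^'n"
  assumes "pos_semidef M" "v \<bullet> (M *v v) = 0"
  shows "M *v v = 0"
  using assms by (intro nonneg_form_kernel[where S = UNIV]) (auto simp: pos_semidef_def)

lemma inner_vec_const:
  fixes x :: "real^'n"
  shows "vec c \<bullet> x = c * (\<Sum>i\<in>UNIV. x $ i)"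
  by (simp add: inner_vec_def sum_distrib_left)

section \<open>Characteristic polynomial and second smallest eigenvalue\<close>

lemma poly_det:
  fixes A :: "'a::comm_ring_1 poly^'n^'n"
  shows "poly (det A) x = det (\<chi> i j. poly (A $ i $ j) x)"
  by (simp add: det_def poly_sum poly_prod poly_mult)

lemma char_polynomial_root:
  fixes M :: "real^'n^'n"
  shows "poly (char_polynomial M) x = 0 \<longleftrightarrow> (\<exists>v. v \<noteq> 0 \<and> M *v v = x *\<^sub>R v)"
proof -
  have "(\<chi> i j. poly ((if i = j then [:0, 1:] else 0) - [:M $ i $ j:]) x) = x *\<^sub>R mat 1 - M"
    by (simp add: vec_eq_iff mat_def)
  then have "poly (char_polynomial M) x = det (x *\<^sub>R mat 1 - M)"
    by (simp add: char_polynomial_def poly_det)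
  moreover have "(x *\<^sub>R mat 1 - M) *v v = 0 \<longleftrightarrow> M *v v = x *\<^sub>R v" for v
    by (auto simp add: matrix_vector_mult_diff_rdistrib scaleR_matrix_vector_assoc[symmetric])
  ultimately show ?thesis
    by (metis invertible_det_nz invertible_left_inverse matrix_left_invertible_ker)
qed

text \<open>The sorted root list is 0 followed by the sorted roots of \<open>q\<close>, so index 1
  holds the least root of \<open>q\<close>. The root \<open>r\<close> guarantees that this entry
  exists; \<open>poly q 0 \<noteq> 0\<close> makes it nonzero.\<close>

lemma nth_eigenvalue_2:
  fixes M :: "real^'n^'n"
  assumes p: "char_polynomial M = [:0, 1:] * q" and q: "poly q 0 \<noteq> 0"
    and nonneg: "\<And>x. poly q x = 0 \<Longrightarrow> 0 \<le> x" and r: "poly q r = 0"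
  shows "0 < nth_eigenvalue 2 M" "nth_eigenvalue 2 M \<le> r"
proof -
  have "q \<noteq> 0"
    using q by auto
  then have set: "set (sorted_list_of_multiset (proots q)) = {x. poly q x = 0}"
    by simp
  have "proots (char_polynomial M) = add_mset 0 (proots q)"
    using proots_mult[of "[:0, 1:]" q] proots_linear_factor[of "0::real"] \<open>q \<noteq> 0\<close>
    by (simp del: mult_pCons_left add: p)
  then have "sorted_list_of_multiset (proots (char_polynomial M))
      = insort 0 (sorted_list_of_multiset (proots q))"
    by simp
  also have "\<dots> = 0 # sorted_list_of_multiset (proots q)"
    using set nonneg by (intro insort_is_Cons) auto
  finally have "nth_eigenvalue 2 M = sorted_list_of_multiset (proots q) ! 0"
    by (simp add: nth_eigenvalue_def)
  moreover obtain y ys where ys: "sorted_list_of_multiset (proots q) = y # ys"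
    using set r by (metis (mono_tags, lifting) empty_iff empty_set mem_Collect_eq neq_Nil_conv)
  moreover have "sorted (y # ys)"
    unfolding ys[symmetric] by simp
  moreover have "r \<in> set (y # ys)" "y \<in> {x. poly q x = 0}"
    using set r unfolding ys by auto
  ultimately have "nth_eigenvalue 2 M \<le> r" "poly q (nth_eigenvalue 2 M) = 0"
    by auto
  then show "0 < nth_eigenvalue 2 M" "nth_eigenvalue 2 M \<le> r"
    using nonneg q by (metis order_le_less)+
qed

section \<open>Laplacians whose kernel consists of the constant vectors\<close>

lemma weighted_laplacian_vec:
  assumes "loopfree_digraph G" and "arcs G = UNIV"
  shows "weighted_laplacian G w *v vec c = 0"
proof -
  \<comment> \<open>Without loops every row of the incidence matrix has exactly one -1 and one 1 and
    so sums to zero; a loop would leave a lone -1.\<close>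
  have "tail G e \<noteq> head G e" for e
    using assms(2) loopfree_digraph.no_loops[OF assms(1), of e] by simp
  then have "(incidence_matrix G *v vec c) $ e = 0" for e
    using not_sym[of "tail G e" "head G e"]
    by (simp add: incidence_matrix_def matrix_vector_mult_def sum.remove[of _ "tail G e"]
        if_distrib[of "\<lambda>y. y * c"] sum.delta cong: if_cong)
  then have "incidence_matrix G *v vec c = 0"
    by (simp add: vec_eq_iff)
  then show ?thesis
    by (simp add: weighted_laplacian_def matrix_vector_mul_assoc[symmetric])
qed

text \<open>Inside the locale the graph is gone: all resistance and eigenvalue bounds are derived
  from these two properties of \<open>L\<close>.\<close>

locale const_kernel =
  fixes L :: "real^'n^'n"
  assumes psd: "pos_semidef L"
    and kernel: "L *v x = 0 \<longleftrightarrow> (\<exists>c. x = vec c)"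
begin

lemma symmetric: "transpose L = L"
  using psd by (simp add: pos_semidef_def)

lemma form_nonneg: "0 \<le> x \<bullet> (L *v x)"
  using psd by (simp add: pos_semidef_def)

lemma vec_orthogonal_range: "vec c \<bullet> (L *v x) = 0"
proof -
  have "L *v vec c = 0"
    using kernel by blast
  then show ?thesis
    by (simp add: symmetric_matrix_inner[OF symmetric])
qed

text \<open>
  The columns of \<open>L\<close> sum to zero, so replacing row \<open>k\<close> of \<open>x I - L\<close> by the sum of all rows turns
  it into \<open>x\<close> times the all-ones row without changing the determinant.
\<close>

lemma char_polynomial_factor:
  obtains q where "char_polynomial L = [:0, 1:] * q" "poly q 0 \<noteq> 0"
proof -
  obtain k :: 'n where True
    by simp
  define C :: "real poly^'n^'n"
    where "C = (\<chi> i j. (if i = j then [:0, 1:] else 0) - [:L $ i $ j:])"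
  define q where "q = det (\<chi> i. if i = k then vec 1 else C $ i)"
  have colsum: "(\<Sum>i\<in>UNIV. L $ i $ j) = 0" for j
    using vec_orthogonal_range[of 1 "axis j 1"]
    by (simp only: inner_vec_const) (simp add: matrix_vector_mult_basis column_def)
  have "(\<Sum>i\<in>UNIV. C $ i) $ j = [:0, 1:]" for j
    using colsum[of j] by (simp add: C_def sum_subtractf sum.delta' add: sum_to_poly)
  then have rowsum: "(\<Sum>i\<in>UNIV. C $ i) = [:0, 1:] *s vec 1"
    by (simp add: vec_eq_iff)
  have "(\<chi> i. if i = k then C $ k else C $ i) = C"
    by (simp add: vec_eq_iff)
  \<comment> \<open>The determinant is linear in row \<open>k\<close>. Among the summands only
    \<open>C $ k\<close> contributes, since any other one repeats a row.\<close>
  moreover have "det (\<chi> i. if i = k then C $ j else C $ i) = 0" if "j \<noteq> k" for j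
    using that by (intro det_identical_rows[of j k]) (auto simp: row_def)
  ultimately have "det (\<chi> i. if i = k then C $ j else C $ i) = (if j = k then det C else 0)" for j
    by metis
  then have "det C = det (\<chi> i. if i = k then (\<Sum>j\<in>UNIV. C $ j) else C $ i)"
    using det_linear_row_sum[of UNIV k "\<lambda>i j. C $ j" "\<lambda>i. C $ i"] by simp
  also have "\<dots> = [:0, 1:] * q"
    unfolding rowsum q_def by (rule det_row_mul)
  finally have "char_polynomial L = [:0, 1:] * q"
    by (simp add: char_polynomial_def C_def)
  moreover have "poly q 0 \<noteq> 0"
  proof -
    \<comment> \<open>\<open>N\<close> is the matrix defining \<open>q\<close>, evaluated at 0. For
      a kernel vector \<open>v\<close>, all entries of \<open>L *v v\<close> except the
      \<open>k\<close>-th vanish, and they sum to zero, so all vanish. Thus \<open>v\<close> is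
      constant with entry sum zero.\<close>
    define N where "N = (\<chi> i j. if i = k then 1 else - L $ i $ j)"
    have "v = 0" if "N *v v = 0" for v
    proof -
      have "(N *v v) $ i = (if i = k then (\<Sum>j\<in>UNIV. v $ j) else - (L *v v) $ i)" for i
        by (simp add: N_def matrix_vector_mult_def sum_negf)
      then have N: "(if i = k then (\<Sum>j\<in>UNIV. v $ j) else - (L *v v) $ i) = 0" for i
        using that by simp
      have Li: "(L *v v) $ i = 0" if "i \<noteq> k" for i
        using N[of i] that by simp
      have sum: "(\<Sum>j\<in>UNIV. v $ j) = 0"
        using N[of k] by simp
      have "0 = (\<Sum>i\<in>UNIV. (L *v v) $ i)"
        using vec_orthogonal_range[of 1 v] by (simp only: inner_vec_const)
      also have "\<dots> = (L *v v) $ k"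
        using Li by (simp add: sum.remove[of _ k])
      finally have "L *v v = 0"
        using Li by (metis vec_eq_iff zero_index)
      then obtain c where "v = vec c"
        using kernel by blast
      then show ?thesis
        using sum by simp
    qed
    then have "det N \<noteq> 0"
      by (metis invertible_det_nz invertible_left_inverse matrix_left_invertible_ker)
    moreover have "(\<chi> i j. poly ((\<chi> i. if i = k then vec 1 else C $ i) $ i $ j) 0) = N"
      by (simp add: N_def C_def vec_eq_iff)
    ultimately show ?thesis
      by (simp only: q_def poly_det) simp
  qed
  ultimately show thesis
    by (rule that)
qed

text \<open>Let \<mu> be the minimum of the form over unit vectors orthogonal to the constants,
  attained at \<open>v\<close>. Then \<open>L - \<mu> *\<^sub>R mat 1\<close> is nonnegative on that
  hyperplane and vanishes at \<open>v\<close>, so \<open>v\<close> is an eigenvector. As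
  \<open>v\<close> is not constant, \<mu> is nonzero and hence a root of \<open>q\<close>, which
  bounds the second eigenvalue by \<mu>.\<close>

lemma nth_eigenvalue_2_rayleigh:
  assumes card: "CARD('n) \<ge> 2"
  shows "0 < nth_eigenvalue 2 L"
    and "vec 1 \<bullet> x = 0 \<Longrightarrow> nth_eigenvalue 2 L * (x \<bullet> x) \<le> x \<bullet> (L *v x)"
proof -
  let ?H = "{x :: real^'n. vec 1 \<bullet> x = 0}"
  have H: "subspace ?H"
    by (rule subspace_hyperplane)
  obtain i j :: 'n where ij: "i \<noteq> j"
    using card by (metis card_le_Suc0_iff_eq finite not_less_eq_eq numeral_2_eq_2)
  \<comment> \<open>Two distinct indices give a nonzero vector in the hyperplane, so its unit sphere
    is nonempty and the infimum is attained.\<close>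
  have "axis i 1 - axis j 1 \<in> ?H \<and> axis i 1 - axis j (1::real) \<noteq> 0"
    using ij by (simp add: inner_diff_right inner_axis axis_eq_axis)
  then obtain h :: "real^'n" where h: "h \<in> ?H" "h \<noteq> 0"
    by blast
  have "compact (?H \<inter> sphere 0 1)"
    by (intro closed_Int_compact compact_sphere closed_hyperplane)
  moreover have "h /\<^sub>R norm h \<in> ?H \<inter> sphere 0 1"
    using h by simp
  moreover have "continuous_on (?H \<inter> sphere 0 1) (\<lambda>x. x \<bullet> (L *v x))"
    by (intro continuous_intros linear_continuous_on) simp
  ultimately obtain v where v: "v \<in> ?H" "v \<in> sphere 0 1"
    and min: "\<And>y. y \<in> ?H \<inter> sphere 0 1 \<Longrightarrow> v \<bullet> (L *v v) \<le> y \<bullet> (L *v y)"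
    using continuous_attains_inf[of "?H \<inter> sphere 0 1" "\<lambda>x. x \<bullet> (L *v x)"] by blast
  define \<mu> where "\<mu> = v \<bullet> (L *v v)"
  have vv: "v \<bullet> v = 1"
    using v by (simp add: norm_eq_1)
  have rayleigh: "\<mu> * (x \<bullet> x) \<le> x \<bullet> (L *v x)" if "x \<in> ?H" for x
  proof (cases "x = 0")
    case False
    then have "\<mu> \<le> (x /\<^sub>R norm x) \<bullet> (L *v (x /\<^sub>R norm x))"
      unfolding \<mu>_def using that by (intro min) simp
    also have "\<dots> = x \<bullet> (L *v x) / (x \<bullet> x)"
      by (simp add: matrix_vector_mult_scaleR dot_square_norm power2_eq_square divide_inverse)
    finally show ?thesis
      using False by (simp add: pos_le_divide_eq)
  qed simp
  define B where "B = L - \<mu> *\<^sub>R mat 1"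
  have B: "B *v x = L *v x - \<mu> *\<^sub>R x" for x
    by (simp add: B_def matrix_vector_mult_diff_rdistrib scaleR_matrix_vector_assoc[symmetric])
  have "B *v v = 0"
  proof (rule nonneg_form_kernel[OF _ H])
    show "transpose B = B"
      by (rule symmetric_matrixI)
        (simp add: B inner_diff_left inner_diff_right symmetric_matrix_inner[OF symmetric])
    show "0 \<le> x \<bullet> (B *v x)" if "x \<in> ?H" for x
      using rayleigh[OF that] by (simp add: B inner_diff_right)
    show "v \<in> ?H"
      by (rule v)
    show "B *v v \<in> ?H"
      using v vec_orthogonal_range[of 1 v] by (simp only: B mem_Collect_eq inner_diff_right) simp
    show "v \<bullet> (B *v v) = 0"
      using vv by (simp add: B inner_diff_right \<mu>_def)
  qed
  then have Lv: "L *v v = \<mu> *\<^sub>R v"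
    by (simp add: B)
  have "v \<noteq> 0"
    using vv by auto
  have "\<mu> \<noteq> 0"
  proof
    assume "\<mu> = 0"
    then obtain c where "v = vec c"
      using Lv kernel[of v] by auto
    then have "vec 1 \<bullet> v = CARD('n) * c"
      by (simp only: inner_vec_const) simp
    then have "c = 0"
      using v(1) by simp
    with \<open>v = vec c\<close> \<open>v \<noteq> 0\<close> show False
      by (simp add: vec_eq_iff)
  qed
  obtain q where p: "char_polynomial L = [:0, 1:] * q" and q: "poly q 0 \<noteq> 0"
    by (rule char_polynomial_factor)
  have roots: "0 \<le> r" if "poly q r = 0" for r
  proof -
    have "poly (char_polynomial L) r = 0"
      using that by (simp add: p)
    then obtain y where "y \<noteq> 0" "L *v y = r *\<^sub>R y"
      using char_polynomial_root by blast
    then show ?thesis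
      using form_nonneg[of y] mult_neg_pos[of r "y \<bullet> y"]
      by (metis inner_gt_zero_iff inner_scaleR_right not_less)
  qed
  have "poly (char_polynomial L) \<mu> = 0"
    using char_polynomial_root Lv \<open>v \<noteq> 0\<close> by blast
  then have "poly q \<mu> = 0"
    using \<open>\<mu> \<noteq> 0\<close> by (simp add: p)
  note ev = nth_eigenvalue_2[OF p q roots this]
  show "0 < nth_eigenvalue 2 L"
    by (rule ev)
  show "nth_eigenvalue 2 L * (x \<bullet> x) \<le> x \<bullet> (L *v x)" if "vec 1 \<bullet> x = 0"
    using mult_right_mono[OF ev(2) inner_ge_zero[of x]] rayleigh[of x] that by simp
qed

text \<open>The right-hand side has entry sum zero, so it is orthogonal to the kernel and the system
  is solvable. Subtracting the mean \<open>m\<close> moves the solution to where the Rayleigh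
  inequality applies.\<close>

lemma potential_exists:
  obtains x where "L *v x = axis i 1 - axis j 1" "vec 1 \<bullet> x = 0"
proof -
  have "(axis i 1 - axis j 1) \<bullet> v = 0" if "L *v v = 0" for v
    using that kernel by (auto simp: inner_diff_left inner_axis')
  then obtain x where x: "L *v x = axis i 1 - axis j 1"
    using symmetric_matrix_solvable[OF symmetric] by blast
  define m where "m = (\<Sum>i\<in>UNIV. x $ i) / CARD('n)"
  show thesis
  proof
    have "L *v vec m = 0"
      using kernel by blast
    then show "L *v (x - vec m) = axis i 1 - axis j 1"
      by (simp add: matrix_vector_mult_diff_distrib x)
    show "vec 1 \<bullet> (x - vec m) = 0"
      by (simp only: inner_vec_const) (simp add: sum_subtractf m_def)
  qed
qed

text \<open>Expand the squared norm of \<open>?d - ?ev *\<^sub>R x\<close>, which is nonnegative.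
  The Rayleigh inequality bounds \<open>?ev * (x \<bullet> x)\<close> by
  \<open>x \<bullet> ?d\<close>, the resistance, leaving
  \<open>0 \<le> 2 - ?ev * (x \<bullet> ?d)\<close>.\<close>

lemma effective_resistance_le:
  assumes "i \<noteq> j"
  shows "effective_resistance L i j \<le> 2 / nth_eigenvalue 2 L"
proof -
  let ?d = "axis i 1 - axis j 1 :: real^'n" and ?ev = "nth_eigenvalue 2 L"
  have card: "CARD('n) \<ge> 2"
    using assms by (metis UNIV_I card_le_Suc0_iff_eq finite not_less_eq_eq numeral_2_eq_2)
  obtain x where x: "L *v x = ?d" "vec 1 \<bullet> x = 0"
    by (rule potential_exists)
  note ev = nth_eigenvalue_2_rayleigh(1)[OF card]
  have "?d \<bullet> ?d = 2"
    using assms by (simp add: inner_diff_left inner_diff_right inner_axis_axis)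
  then have "0 \<le> 2 - 2 * ?ev * (x \<bullet> ?d) + ?ev * (?ev * (x \<bullet> x))"
    using inner_ge_zero[of "?d - ?ev *\<^sub>R x"]
    by (simp add: inner_diff_left inner_diff_right inner_commute algebra_simps)
  also have "?ev * (?ev * (x \<bullet> x)) \<le> ?ev * (x \<bullet> ?d)"
    using nth_eigenvalue_2_rayleigh(2)[OF card x(2)] ev x(1) by simp
  finally have "x \<bullet> ?d \<le> 2 / ?ev"
    using ev by (simp add: field_simps)
  then show ?thesis
    by (simp add: effective_resistance_def pseudoinverse_quadratic_form[OF symmetric x(1)])
qed

lemma approx_resistance_bounds:
  assumes "i \<noteq> j"
  shows "0 \<le> approx_resistance L i j" "approx_resistance L i j \<le> effective_resistance L i j"
proof -
  let ?M = "principal_submatrix2 L i j" and ?d = "vector [1, - 1] :: real^2"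
  \<comment> \<open>Extension by zero outside \<open>i\<close> and \<open>j\<close>;
    \<open>form\<close> and \<open>dlift\<close> express the 2-by-2 data through
    \<open>L\<close>.\<close>
  define lift where "lift y = y $ 1 *\<^sub>R axis i 1 + y $ 2 *\<^sub>R axis j (1::real)" for y :: "real^2"
  have Lji: "L $ j $ i = L $ i $ j"
    using symmetric by (metis transpose_def vec_lambda_beta)
  have symM: "transpose ?M = ?M"
    by (simp add: transpose_def principal_submatrix2_def vec_eq_iff forall_2 Lji)
  have form: "y \<bullet> (?M *v y) = lift y \<bullet> (L *v lift y)" for y
    by (simp add: lift_def principal_submatrix2_def inner_vec_def[of y] sum_2
        matrix_vector_mult_def[of _ y] matrix_vector_right_distrib
        matrix_vector_mult_scaleR matrix_vector_mult_basis column_def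
        inner_add_left inner_axis' Lji algebra_simps)
  have dlift: "y \<bullet> ?d = lift y \<bullet> (axis i 1 - axis j 1)" for y
    using assms by (simp add: lift_def inner_vec_def[of y] sum_2 inner_add_left inner_diff_right
        inner_axis_axis)
  \<comment> \<open>A kernel vector of \<open>?M\<close> lifts to a zero of the form of
    \<open>L\<close>, hence to a constant vector. This also covers a graph with just two nodes,
    where \<open>?M\<close> is singular.\<close>
  have "?d \<bullet> y = 0" if "?M *v y = 0" for y
  proof -
    have "L *v lift y = 0"
      using form[of y] that by (intro pos_semidef_kernel[OF psd]) simp
    then obtain c where "lift y = vec c"
      using kernel by blast
    then have "lift y \<bullet> (axis i 1 - axis j 1) = 0"
      by (simp add: inner_diff_right inner_axis)
    then show ?thesis
      using dlift[of y] by (simp add: inner_commute)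
  qed
  then obtain y where y: "?M *v y = ?d"
    using symmetric_matrix_solvable[OF symM] by blast
  obtain x where x: "L *v x = axis i 1 - axis j 1"
    by (rule potential_exists)
  have approx: "approx_resistance L i j = y \<bullet> ?d"
    by (simp add: approx_resistance_def pseudoinverse_quadratic_form[OF symM y])
  have eff: "effective_resistance L i j = x \<bullet> (axis i 1 - axis j 1)"
    by (simp add: effective_resistance_def pseudoinverse_quadratic_form[OF symmetric x])
  have form_y: "lift y \<bullet> (L *v lift y) = y \<bullet> ?d"
    by (simp flip: form add: y)
  then show "0 \<le> approx_resistance L i j"
    using form_nonneg[of "lift y"] by (simp add: approx)
  have "0 \<le> (x - lift y) \<bullet> (L *v (x - lift y))"
    by (rule form_nonneg)
  also have "\<dots> = x \<bullet> (L *v x) - 2 * (lift y \<bullet> (L *v x)) + lift y \<bullet> (L *v lift y)"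
    using symmetric_matrix_inner[OF symmetric, of x "lift y"]
    by (simp add: matrix_vector_mult_diff_distrib inner_diff_left inner_diff_right inner_commute)
  \<comment> \<open>The cross term \<open>lift y \<bullet> (L *v x)\<close> equals
    \<open>y \<bullet> ?d\<close>, the approximation, as does the last term.\<close>
  also have "\<dots> = effective_resistance L i j - approx_resistance L i j"
    by (simp add: x form_y eff approx flip: dlift)
  finally show "approx_resistance L i j \<le> effective_resistance L i j"
    by simp
qed

end

section \<open>The kernel from the rank, and the resistance bounds\<close>

lemma const_kernelI:
  fixes L :: "real^'n^'n"
  assumes psd: "pos_semidef L" and const: "\<And>c. L *v vec c = 0" and rank: "rank L = CARD('n) - 1"
  shows "const_kernel L"
proof
  fix x :: "real^'n"
  have sym: "transpose L = L"
    using psd by (simp add: pos_semidef_def)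
  \<comment> \<open>The kernel of a symmetric matrix is the orthogonal complement of its range, so
    the rank leaves it one dimension, which the constants fill.\<close>
  have "{y \<in> UNIV. \<forall>x\<in>range (\<lambda>x. L *v x). orthogonal x y} = {y. L *v y = 0}"
    by (auto simp: orthogonal_def symmetric_matrix_inner[OF sym, symmetric])
      (metis inner_eq_zero_iff symmetric_matrix_inner[OF sym])
  then have "dim {y. L *v y = 0} + rank L = CARD('n)"
    using dim_subspace_orthogonal_to_vectors[of "range (\<lambda>x. L *v x)" UNIV]
    by (simp add: linear_subspace_image rank_dim_range)
  \<comment> \<open>Positivity of \<open>CARD('n)\<close> rules out truncation in
    \<open>CARD('n) - 1\<close>.\<close>
  then have "dim {y. L *v y = 0} = 1"
    using rank zero_less_card_finite[where 'a = 'n] by linarith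
  moreover have "dim (span {vec 1 :: real^'n}) = 1"
    by (simp del: vec_1 add: vec_eq_iff)
  moreover have "subspace {y. L *v y = 0}"
    by (simp add: linear_subspace_kernel)
  moreover have "span {vec 1} \<subseteq> {y. L *v y = 0}"
    using const[of 1] calculation(3) by (intro span_minimal) auto
  ultimately have "span {vec 1} = {y. L *v y = 0}"
    by (intro subspace_dim_equal) auto
  moreover have "x \<in> span {vec 1} \<longleftrightarrow> (\<exists>c. x = vec c)"
    by (simp add: span_singleton vec_eq_iff image_iff)
  ultimately show "L *v x = 0 \<longleftrightarrow> (\<exists>c. x = vec c)"
    by auto
qed (rule psd)

theorem theorem8:
  fixes G :: "('n::finite, 'm::finite) pre_digraph"
    and w :: "'m \<Rightarrow> real"
    and L :: "real^'n^'n"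
    and \<gamma> :: real
  assumes "loopfree_digraph G" and "verts G = UNIV" and "arcs G = UNIV"
    and "Digraph_Component.connected G"
    and "L = weighted_laplacian G w"
    and "pos_semidef L"
    and "rank L = CARD('n) - 1"
    and "\<gamma> = 2 / nth_eigenvalue 2 L"
  shows "(\<forall>i j. i \<noteq> j \<longrightarrow> approx_resistance L i j \<le> effective_resistance L i j)
    \<and> (\<forall>i j k. distinct [i, j, k] \<longrightarrow>
          (approx_resistance L i j - approx_resistance L i k < - \<gamma> \<longrightarrow>
             effective_resistance L i j - effective_resistance L i k < 0) \<and>
          (approx_resistance L i j - approx_resistance L i k > \<gamma> \<longrightarrow>
             effective_resistance L i j - effective_resistance L i k > 0))
    \<and> (\<forall>i j k. distinct [i, j, k] \<longrightarrow>
          \<bar>(approx_resistance L i j - approx_resistance L i k)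
            - (effective_resistance L i j - effective_resistance L i k)\<bar>
          \<le> 2 / nth_eigenvalue 2 L)"
proof -
  interpret const_kernel L
    using assms(6,7) weighted_laplacian_vec[OF assms(1,3)] unfolding assms(5)
    by (intro const_kernelI)
  note bounds = approx_resistance_bounds effective_resistance_le
  have close: "\<bar>(approx_resistance L i j - approx_resistance L i k)
      - (effective_resistance L i j - effective_resistance L i k)\<bar> \<le> 2 / nth_eigenvalue 2 L"
    if "distinct [i, j, k]" for i j k
    using bounds[of i j] bounds[of i k] that by simp
  \<comment> \<open>The sign claims follow from \<open>close\<close>: a change of at most \<gamma>
    cannot reverse the sign of a difference exceeding \<gamma> in absolute value.\<close>
  show ?thesis
    using close approx_resistance_bounds(2) unfolding assms(8) by (fastforce simp: abs_le_iff)
qed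

end
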